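(* Let $f,g_1,\ldots,g_m\in\mathbb{R}[\mathbf{x}]$ be real polynomials in $\mathbf{x}=(x_1,\ldots,x_n)$, and let $\mathbf{K}=\{\mathbf{x}\in\mathbb{R}^n : g_j(\mathbf{x})\ge 0,\ j=1,\ldots,m\}$. Assume that $\mathbf{K}$ is compact, that $0\le g_j\le1$ on $\mathbf{K}$ for all $j$, and that the family $\{g_j,\,1-g_j : j=1,\ldots,m\}$ generates the algebra $\mathbb{R}[\mathbf{x}]$. Let $f^*=\min\{f(\mathbf{x}):\mathbf{x}\in\mathbf{K}\}$ and let $\mathbf{x}^*\in\mathbf{K}$ be a global minimizer, i.e. $f(\mathbf{x}^* )=f^*$. Let $d,k\in\mathbb{N}$ be fixed ($k\ge0$). Suppose that the level-$d$ semidefinite relaxation $$q^k_d=\max_{\lambda,t,\sigma}\Big\{t : f-\sum_{(\alpha,\beta)\in\mathbb{N}^{2m}_d}\lambda_{\alpha\beta}\Big(\prod_{j=1}^m g_j^{\alpha_j}\Big)\Big(\prod_{j=1}^m(1-g_j)^{\beta_j}\Big)-t=\sigma;\ \lambda\ge0,\ t\in\mathbb{R},\ \sigma\in\Sigma[\mathbf{x}]_k\Big\}$$ is exact, i.e. it has an optimal solution $(\lambda^*,t^*,\sigma)$ with $t^*=q^k_d=f^*$, and let $\mathbf{V}\subset\mathbb{R}^n$ be the real variety associated with $\lambda^*$ and $\mathbf{x}^*$ as defined in the context. Then $f^*$ is also the global optimum, and $\mathbf{x}^*$ is also a global minimizer, of the problem $$\min_{\mathbf{x}}\{f(\mathbf{x})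 : \mathbf{x}\in\mathbf{V}\}.$$ Moreover, if $k=0$ then $f$ is constant on $\mathbf{V}$.
   Context: $\mathbb{N}^{2m}_d=\{(\alpha,\beta)\in\mathbb{N}^m\times\mathbb{N}^m : \sum_{j=1}^m(\alpha_j+\beta_j)\le d\}$, where $\mathbb{N}$ includes $0$; $\lambda=(\lambda_{\alpha\beta})$ is a real vector indexed by $\mathbb{N}^{2m}_d$, and $\lambda\ge0$ means all its entries are nonnegative. $\Sigma[\mathbf{x}]_k$ is the set of polynomials of degree at most $2k$ that are sums of squares of polynomials. Active sets at $\mathbf{x}^*$: $I_1(\mathbf{x}^* )=\{j\in\{1,\ldots,m\}: g_j(\mathbf{x}^* )=0\}$ and $I_2(\mathbf{x}^* )=\{j\in\{1,\ldots,m\}: 1-g_j(\mathbf{x}^* )=0\}$. Definition of $\mathbf{V}$: let $\Omega=\{(\alpha,\beta)\in\mathbb{N}^{2m}_d : \lambda^*_{\alpha\beta}>0\}$ and, for $(\alpha,\beta)\in\Omega$, let $J^1_{\alpha\beta}=\{j\in I_1(\mathbf{x}^* ):\alpha_j>0\}$ and $J^2_{\alpha\beta}=\{j\in I_2(\mathbf{x}^* ):\beta_j>0\}$. Then $$\mathbf{V}=\Big\{\mathbf{x}\in\mathbb{R}^n : \Big(\prod_{j\in J^1_{\alpha\beta}}g_j(\mathbf{x})\Big)\Big(\prod_{j\in J^2_{\alpha\beta}}(1-g_j(\mathbf{x}))\Big)=0\ \ \forall(\alpha,\beta)\in\Omega\Big\},$$ with empty products equal to $1$. *)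

theory Defs
  imports "HOL-Analysis.Analysis" "HOL-Library.Poly_Mapping"
begin

section \<open>Real multivariate polynomials\<close>

text \<open>
  A polynomial in variables indexed by the finite type \<open>'n\<close> maps exponent vectors to
  coefficients with finite support. Its ring structure is the convolution product of
  \<^typ>\<open>('a, 'b) poly_mapping\<close>.
\<close>

type_synonym 'n real_mpoly = "('n \<Rightarrow>\<^sub>0 nat) \<Rightarrow>\<^sub>0 real"

definition const_mpoly :: "real \<Rightarrow> 'n real_mpoly" where
  "const_mpoly c = Poly_Mapping.single 0 c"

definition eval_mpoly :: "'n::finite real_mpoly \<Rightarrow> real ^ 'n \<Rightarrow> real" where
  "eval_mpoly p x =
     (\<Sum>a\<in>Poly_Mapping.keys p.
        Poly_Mapping.lookup p a * (\<Prod>i\<in>UNIV. (x $ i) ^ Poly_Mapping.lookup a i))"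

text \<open>The zero polynomial is given total degree 0.\<close>

definition total_degree :: "'n::finite real_mpoly \<Rightarrow> nat" where
  "total_degree p =
     Max (insert 0 ((\<lambda>a. \<Sum>i\<in>UNIV. Poly_Mapping.lookup a i) ` Poly_Mapping.keys p))"

definition sos_mpoly :: "nat \<Rightarrow> 'n::finite real_mpoly set" where
  "sos_mpoly k =
     {p. total_degree p \<le> 2 * k \<and> (\<exists>qs. p = sum_list (map (\<lambda>q. q ^ 2) qs))}"

inductive_set generated_algebra :: "'n real_mpoly set \<Rightarrow> 'n real_mpoly set"
  for G :: "'n real_mpoly set" where
  "p \<in> G \<Longrightarrow> p \<in> generated_algebra G"
| "const_mpoly c \<in> generated_algebra G"
| "p \<in> generated_algebra G \<Longrightarrow> q \<in> generated_algebra G \<Longrightarrow> p + q \<in> generated_algebra G"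
| "p \<in> generated_algebra G \<Longrightarrow> q \<in> generated_algebra G \<Longrightarrow> p * q \<in> generated_algebra G"

lemma eval_mpoly_superset:
  fixes p :: "'n::finite real_mpoly"
  assumes "finite S" "Poly_Mapping.keys p \<subseteq> S"
  shows "eval_mpoly p x =
    (\<Sum>a\<in>S. Poly_Mapping.lookup p a * (\<Prod>i\<in>UNIV. (x $ i) ^ Poly_Mapping.lookup a i))"
  unfolding eval_mpoly_def
  by (rule sum.mono_neutral_left) (use assms in \<open>auto simp: in_keys_iff\<close>)

lemma eval_mpoly_single:
  "eval_mpoly (Poly_Mapping.single a c) x = c * (\<Prod>i\<in>UNIV. (x $ i) ^ Poly_Mapping.lookup a i)"
  using eval_mpoly_superset[of "{a}" "Poly_Mapping.single a c"] by simp

lemma eval_mpoly_const: "eval_mpoly (const_mpoly c) x = c"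
  by (simp add: const_mpoly_def eval_mpoly_single)

lemma eval_mpoly_add: "eval_mpoly (p + q) x = eval_mpoly p x + eval_mpoly q x"
proof -
  let ?S = "Poly_Mapping.keys p \<union> Poly_Mapping.keys q"
  have "Poly_Mapping.keys (p + q) \<subseteq> ?S"
    by (rule Poly_Mapping.keys_add)
  then show ?thesis
    by (simp add: eval_mpoly_superset[of ?S] lookup_add distrib_right sum.distrib)
qed

lemma eval_mpoly_sum: "eval_mpoly (sum h A) x = (\<Sum>a\<in>A. eval_mpoly (h a) x)"
proof (induction A rule: infinite_finite_induct)
  case (insert a A)
  then show ?case
    by (simp add: eval_mpoly_add)
qed (simp_all add: eval_mpoly_def)

lemma mpoly_sum_single:
  fixes p :: "'n real_mpoly"
  shows "(\<Sum>a\<in>Poly_Mapping.keys p. Poly_Mapping.single a (Poly_Mapping.lookup p a)) = p"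
  by (rule poly_mapping_eqI)
    (auto simp: lookup_sum lookup_single when_def in_keys_iff sum.delta)

lemma eval_mpoly_mult: "eval_mpoly (p * q) x = eval_mpoly p x * eval_mpoly q x"
proof -
  let ?s = "\<lambda>p a. Poly_Mapping.single a (Poly_Mapping.lookup p a)"
  have "eval_mpoly (?s p a * ?s q b) x = eval_mpoly (?s p a) x * eval_mpoly (?s q b) x" for a b
    by (simp add: mult_single eval_mpoly_single lookup_add power_add prod.distrib)
  then have "eval_mpoly (sum (?s p) A * sum (?s q) B) x =
      eval_mpoly (sum (?s p) A) x * eval_mpoly (sum (?s q) B) x" for A B
    by (simp add: sum_product eval_mpoly_sum)
  from this[of "Poly_Mapping.keys p" "Poly_Mapping.keys q"] show ?thesis
    by (simp only: mpoly_sum_single)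
qed

section \<open>Minimum and maximum of a set of reals\<close>

definition is_minimum :: "real \<Rightarrow> real set \<Rightarrow> bool" where
  "is_minimum v S \<longleftrightarrow> v \<in> S \<and> (\<forall>w\<in>S. v \<le> w)"

definition is_maximum :: "real \<Rightarrow> real set \<Rightarrow> bool" where
  "is_maximum v S \<longleftrightarrow> v \<in> S \<and> (\<forall>w\<in>S. w \<le> v)"

section \<open>The semidefinite relaxation\<close>

definition feasible_set :: "('m::finite \<Rightarrow> 'n::finite real_mpoly) \<Rightarrow> (real ^ 'n) set" where
  "feasible_set g = {x. \<forall>j. 0 \<le> eval_mpoly (g j) x}"

definition multi_indices :: "nat \<Rightarrow> (('m::finite \<Rightarrow> nat) \<times> ('m \<Rightarrow> nat)) set" where
  "multi_indices d = {(\<alpha>, \<beta>). (\<Sum>j\<in>UNIV. \<alpha> j + \<beta> j) \<le> d}"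

lemma finite_multi_indices:
  "finite (multi_indices d :: (('m::finite \<Rightarrow> nat) \<times> ('m \<Rightarrow> nat)) set)"
proof -
  let ?F = "PiE (UNIV :: 'm set) (\<lambda>_. {..d})"
  have "\<alpha> j \<le> d \<and> \<beta> j \<le> d" if "(\<Sum>j\<in>UNIV. \<alpha> j + \<beta> j) \<le> d"
    for \<alpha> \<beta> :: "'m \<Rightarrow> nat" and j
    using member_le_sum[of j UNIV "\<lambda>j. \<alpha> j + \<beta> j"] that by simp
  then have "(multi_indices d :: (('m \<Rightarrow> nat) \<times> ('m \<Rightarrow> nat)) set) \<subseteq> ?F \<times> ?F"
    by (auto simp: multi_indices_def)
  moreover have "finite (?F \<times> ?F)"
    by (intro finite_cartesian_product finite_PiE) auto
  ultimately show ?thesis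
    by (rule finite_subset)
qed

text \<open>
  The multiplier vector \<open>\<lambda>\<close> is a total function, but only its entries at \<^term>\<open>multi_indices d\<close>
  are ever used.
\<close>

definition relaxation_feasible ::
  "'n::finite real_mpoly \<Rightarrow> ('m::finite \<Rightarrow> 'n real_mpoly) \<Rightarrow> nat \<Rightarrow> nat \<Rightarrow>
   (('m \<Rightarrow> nat) \<times> ('m \<Rightarrow> nat) \<Rightarrow> real) \<times> real \<times> 'n real_mpoly \<Rightarrow> bool" where
  "relaxation_feasible f g d k = (\<lambda>(lam, t, \<sigma>).
     f - (\<Sum>(\<alpha>, \<beta>)\<in>multi_indices d.
            const_mpoly (lam (\<alpha>, \<beta>)) * (\<Prod>j\<in>UNIV. g j ^ \<alpha> j) * (\<Prod>j\<in>UNIV. (1 - g j) ^ \<beta> j))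
       - const_mpoly t = \<sigma> \<and>
     (\<forall>ab\<in>multi_indices d. 0 \<le> lam ab) \<and>
     \<sigma> \<in> sos_mpoly k)"

definition relaxation_values ::
  "'n::finite real_mpoly \<Rightarrow> ('m::finite \<Rightarrow> 'n real_mpoly) \<Rightarrow> nat \<Rightarrow> nat \<Rightarrow> real set" where
  "relaxation_values f g d k = {t. \<exists>lam \<sigma>. relaxation_feasible f g d k (lam, t, \<sigma>)}"

section \<open>The variety associated with a multiplier vector\<close>

definition active_lower :: "('m::finite \<Rightarrow> 'n::finite real_mpoly) \<Rightarrow> real ^ 'n \<Rightarrow> 'm set" where
  "active_lower g x = {j. eval_mpoly (g j) x = 0}"

definition active_upper :: "('m::finite \<Rightarrow> 'n::finite real_mpoly) \<Rightarrow> real ^ 'n \<Rightarrow> 'm set" where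
  "active_upper g x = {j. 1 - eval_mpoly (g j) x = 0}"

definition positive_support ::
  "nat \<Rightarrow> (('m::finite \<Rightarrow> nat) \<times> ('m \<Rightarrow> nat) \<Rightarrow> real) \<Rightarrow> (('m \<Rightarrow> nat) \<times> ('m \<Rightarrow> nat)) set" where
  "positive_support d lam = {ab \<in> multi_indices d. lam ab > 0}"

definition associated_variety ::
  "('m::finite \<Rightarrow> 'n::finite real_mpoly) \<Rightarrow> nat \<Rightarrow>
   (('m \<Rightarrow> nat) \<times> ('m \<Rightarrow> nat) \<Rightarrow> real) \<Rightarrow> real ^ 'n \<Rightarrow> (real ^ 'n) set" where
  "associated_variety g d lam xs =
     {x. \<forall>(\<alpha>, \<beta>)\<in>positive_support d lam.
           (\<Prod>j\<in>{j \<in> active_lower g xs. \<alpha> j > 0}. eval_mpoly (g j) x) *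
           (\<Prod>j\<in>{j \<in> active_upper g xs. \<beta> j > 0}. 1 - eval_mpoly (g j) x) = 0}"

end

theory Submission
  imports Defs
begin

text \<open>
  An exact relaxation is a certificate
  \<open>f = f\<^sup>* + (\<Sum>\<lambda>\<^sub>\<alpha>\<^sub>\<beta> g\<^sup>\<alpha> (1 - g)\<^sup>\<beta>) + \<sigma>\<close>, an identity of polynomials, so that
  it may be evaluated at points outside the feasible set as well.

  At the minimizer \<open>x\<^sup>*\<close> both sides equal \<open>f\<^sup>*\<close>, and all products and \<open>\<sigma>\<close> are nonnegative there.
  Hence \<open>\<sigma>\<close> and every product with positive multiplier vanish at \<open>x\<^sup>*\<close>
  (\<open>certificate_slackness\<close>). A product vanishes only through one of its factors, which is then a
  constraint active at \<open>x\<^sup>*\<close>; this puts \<open>x\<^sup>*\<close> in the variety \<open>V\<close>.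

  Conversely, \<open>V\<close> is cut out so that each product with positive multiplier has a factor vanishing
  at every point of \<open>V\<close>. There the certificate collapses to \<open>f = f\<^sup>* + \<sigma>\<close>
  (\<open>certificate_on_variety\<close>): the inequality constraints have disappeared, and
  \<open>f \<ge> f\<^sup>*\<close> because \<open>\<sigma>\<close> is a sum of squares. For \<open>k = 0\<close> the polynomial \<open>\<sigma>\<close> has degree 0,
  so \<open>f\<close> is constant on \<open>V\<close>.
\<close>

lemma eval_mpoly_one: "eval_mpoly 1 x = 1"
  using eval_mpoly_const[of 1 x] by (simp add: const_mpoly_def)

lemma eval_mpoly_zero: "eval_mpoly 0 x = 0"
  by (simp add: eval_mpoly_def)

lemma eval_mpoly_diff: "eval_mpoly (p - q) x = eval_mpoly p x - eval_mpoly q x"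
  using eval_mpoly_add[of "p - q" q x] by simp

lemma eval_mpoly_power: "eval_mpoly (p ^ e) x = eval_mpoly p x ^ e"
  by (induction e) (simp_all add: eval_mpoly_one eval_mpoly_mult)

lemma eval_mpoly_prod: "eval_mpoly (prod h A) x = (\<Prod>a\<in>A. eval_mpoly (h a) x)"
  by (induction A rule: infinite_finite_induct) (simp_all add: eval_mpoly_one eval_mpoly_mult)

lemmas eval_mpoly_simps = eval_mpoly_one eval_mpoly_zero eval_mpoly_const eval_mpoly_add
  eval_mpoly_diff eval_mpoly_mult eval_mpoly_power eval_mpoly_sum eval_mpoly_prod

lemma eval_sos_nonneg:
  assumes "\<sigma> \<in> sos_mpoly k"
  shows "0 \<le> eval_mpoly \<sigma> x"
proof -
  obtain qs where qs: "\<sigma> = sum_list (map (\<lambda>q. q ^ 2) qs)"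
    using assms by (auto simp: sos_mpoly_def)
  have "0 \<le> eval_mpoly (sum_list (map (\<lambda>q. q ^ 2) qs)) x"
    by (induction qs) (simp_all add: eval_mpoly_simps)
  then show ?thesis
    by (simp add: qs)
qed

lemma eval_mpoly_degree_0:
  assumes "total_degree p = 0"
  shows "eval_mpoly p x = eval_mpoly p y"
proof -
  have "Poly_Mapping.lookup a i = 0" if a: "a \<in> Poly_Mapping.keys p" for a i
  proof -
    have "(\<Sum>i\<in>UNIV. Poly_Mapping.lookup a i) \<le> total_degree p"
      unfolding total_degree_def using a by (intro Max_ge) auto
    then show ?thesis
      using assms by simp
  qed
  then show ?thesis
    by (simp add: eval_mpoly_def)
qed

lemma weighted_product_eq_0_iff:
  fixes u v :: "'m::finite \<Rightarrow> real"
  shows "(\<Prod>j\<in>UNIV. u j ^ \<alpha> j) * (\<Prod>j\<in>UNIV. v j ^ \<beta> j) = 0 \<longleftrightarrow>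
    (\<exists>j. \<alpha> j > 0 \<and> u j = 0) \<or> (\<exists>j. \<beta> j > 0 \<and> v j = 0)"
  by auto

text \<open>
  The defining products are squarefree and run over constraints active at \<open>xs\<close>. Naming a
  vanishing factor makes membership comparable with the vanishing of the products
  \<open>g\<^sup>\<alpha> (1 - g)\<^sup>\<beta>\<close> by \<open>weighted_product_eq_0_iff\<close>: on the variety the factor makes the full product vanish, and
  for \<open>x = xs\<close> both conditions say the same.
\<close>

lemma mem_associated_variety_iff:
  "x \<in> associated_variety g d lam xs \<longleftrightarrow>
    (\<forall>(\<alpha>, \<beta>)\<in>positive_support d lam.
      (\<exists>j. \<alpha> j > 0 \<and> eval_mpoly (g j) xs = 0 \<and> eval_mpoly (g j) x = 0) \<or>
      (\<exists>j. \<beta> j > 0 \<and> 1 - eval_mpoly (g j) xs = 0 \<and> 1 - eval_mpoly (g j) x = 0))"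
  unfolding associated_variety_def active_lower_def active_upper_def
  by (simp add: split_beta conj_left_commute)

lemma certificate_eval:
  assumes "relaxation_feasible f g d k (lam, t, \<sigma>)"
  shows "eval_mpoly f x = t + (\<Sum>(\<alpha>, \<beta>)\<in>multi_indices d. lam (\<alpha>, \<beta>) *
      ((\<Prod>j\<in>UNIV. eval_mpoly (g j) x ^ \<alpha> j) * (\<Prod>j\<in>UNIV. (1 - eval_mpoly (g j) x) ^ \<beta> j)))
    + eval_mpoly \<sigma> x"
proof -
  have "\<sigma> = f - (\<Sum>(\<alpha>, \<beta>)\<in>multi_indices d.
      const_mpoly (lam (\<alpha>, \<beta>)) * (\<Prod>j\<in>UNIV. g j ^ \<alpha> j) * (\<Prod>j\<in>UNIV. (1 - g j) ^ \<beta> j))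
      - const_mpoly t"
    using assms by (simp add: relaxation_feasible_def)
  then show ?thesis
    by (simp add: eval_mpoly_simps split_beta mult.assoc)
qed

text \<open>
  Complementary slackness: where the certified bound is attained, a sum of nonnegative terms is 0.
\<close>

lemma certificate_slackness:
  assumes feas: "relaxation_feasible f g d k (lam, t, \<sigma>)"
    and box: "\<And>j. 0 \<le> eval_mpoly (g j) x \<and> eval_mpoly (g j) x \<le> 1"
    and exact: "eval_mpoly f x = t"
  shows "eval_mpoly \<sigma> x = 0"
    and "(\<alpha>, \<beta>) \<in> positive_support d lam \<Longrightarrow>
      (\<Prod>j\<in>UNIV. eval_mpoly (g j) x ^ \<alpha> j) * (\<Prod>j\<in>UNIV. (1 - eval_mpoly (g j) x) ^ \<beta> j) = 0"
proof -
  let ?P = "\<lambda>\<alpha> \<beta>. (\<Prod>j\<in>UNIV. eval_mpoly (g j) x ^ \<alpha> j) *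
    (\<Prod>j\<in>UNIV. (1 - eval_mpoly (g j) x) ^ \<beta> j)"
  let ?T = "\<lambda>(\<alpha>, \<beta>). lam (\<alpha>, \<beta>) * ?P \<alpha> \<beta>"
  have P: "0 \<le> ?P \<alpha> \<beta>" for \<alpha> \<beta>
    using box by (intro mult_nonneg_nonneg prod_nonneg zero_le_power) auto
  have T: "0 \<le> ?T ab" if "ab \<in> multi_indices d" for ab
    using that feas by (cases ab) (auto simp: relaxation_feasible_def intro!: mult_nonneg_nonneg P)
  have sum: "0 \<le> sum ?T (multi_indices d)"
    using T by (rule sum_nonneg)
  have sos: "0 \<le> eval_mpoly \<sigma> x"
    using feas by (auto simp: relaxation_feasible_def intro: eval_sos_nonneg)
  have total: "sum ?T (multi_indices d) + eval_mpoly \<sigma> x = 0"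
    using certificate_eval[OF feas, of x] exact by simp
  from total sum sos show "eval_mpoly \<sigma> x = 0"
    by linarith
  from total sum sos have "sum ?T (multi_indices d) = 0"
    by linarith
  then have zero: "?T ab = 0" if "ab \<in> multi_indices d" for ab
    using that T sum_nonneg_eq_0_iff[OF finite_multi_indices, of d ?T] by blast
  show "?P \<alpha> \<beta> = 0" if "(\<alpha>, \<beta>) \<in> positive_support d lam"
    using zero[of "(\<alpha>, \<beta>)"] that by (simp only: positive_support_def) auto
qed

text \<open>
  Nothing is known about the sign of the \<open>g\<^sub>j\<close> and \<open>1 - g\<^sub>j\<close> at points of the variety, so the terms
  of the certificate have to vanish one by one: either the multiplier is 0, or it is positive and
  the variety supplies a vanishing factor.
\<close>

lemma certificate_on_variety:
  assumes feas: "relaxation_feasible f g d k (lam, t, \<sigma>)"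
    and x: "x \<in> associated_variety g d lam xs"
  shows "eval_mpoly f x = t + eval_mpoly \<sigma> x"
proof -
  let ?P = "\<lambda>\<alpha> \<beta>. (\<Prod>j\<in>UNIV. eval_mpoly (g j) x ^ \<alpha> j) *
    (\<Prod>j\<in>UNIV. (1 - eval_mpoly (g j) x) ^ \<beta> j)"
  have "lam (\<alpha>, \<beta>) * ?P \<alpha> \<beta> = 0" if ab: "(\<alpha>, \<beta>) \<in> multi_indices d" for \<alpha> \<beta>
  proof (cases "lam (\<alpha>, \<beta>) = 0")
    case False
    then have "(\<alpha>, \<beta>) \<in> positive_support d lam"
      using ab feas by (force simp: positive_support_def relaxation_feasible_def)
    then have "?P \<alpha> \<beta> = 0"
      using x unfolding mem_associated_variety_iff weighted_product_eq_0_iff by blast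
    then show ?thesis
      by simp
  qed simp
  then have "(\<Sum>(\<alpha>, \<beta>)\<in>multi_indices d. lam (\<alpha>, \<beta>) * ?P \<alpha> \<beta>) = 0"
    by (intro sum.neutral) auto
  then show ?thesis
    using certificate_eval[OF feas, of x] by simp
qed

theorem corollary4p1:
  fixes f :: "'n::finite real_mpoly"
    and g :: "'m::finite \<Rightarrow> 'n real_mpoly"
    and fstar q tstar :: real
    and xstar :: "real ^ 'n"
    and d k :: nat
    and lam :: "('m \<Rightarrow> nat) \<times> ('m \<Rightarrow> nat) \<Rightarrow> real"
    and \<sigma> :: "'n real_mpoly"
  assumes "compact (feasible_set g)"
    and "\<forall>x\<in>feasible_set g. \<forall>j. 0 \<le> eval_mpoly (g j) x \<and> eval_mpoly (g j) x \<le> 1"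
    and "generated_algebra (range g \<union> range (\<lambda>j. 1 - g j)) = UNIV"
    and "is_minimum fstar (eval_mpoly f ` feasible_set g)"
    and "xstar \<in> feasible_set g"
    and "eval_mpoly f xstar = fstar"
    and "is_maximum q (relaxation_values f g d k)"
    and "is_arg_max (\<lambda>(_, t, _). t) (relaxation_feasible f g d k) (lam, tstar, \<sigma>)"
    and "tstar = q"
    and "q = fstar"
  shows "is_minimum fstar (eval_mpoly f ` associated_variety g d lam xstar)
    \<and> is_arg_min (eval_mpoly f) (\<lambda>x. x \<in> associated_variety g d lam xstar) xstar
    \<and> (k = 0 \<longrightarrow> eval_mpoly f constant_on associated_variety g d lam xstar)"
proof -
  let ?V = "associated_variety g d lam xstar"
  have feas: "relaxation_feasible f g d k (lam, fstar, \<sigma>)"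
    using assms(8-10) by (simp add: is_arg_max_def)
  then have sos: "\<sigma> \<in> sos_mpoly k"
    by (simp add: relaxation_feasible_def)
  have box: "0 \<le> eval_mpoly (g j) xstar \<and> eval_mpoly (g j) xstar \<le> 1" for j
    using assms(2,5) by blast
  note slack = certificate_slackness[OF feas box assms(6)]
  have "xstar \<in> ?V"
    using slack(2) unfolding mem_associated_variety_iff weighted_product_eq_0_iff by blast
  moreover have on_V: "eval_mpoly f x = fstar + eval_mpoly \<sigma> x" if "x \<in> ?V" for x
    using certificate_on_variety[OF feas that] .
  then have "fstar \<le> eval_mpoly f x" if "x \<in> ?V" for x
    using that eval_sos_nonneg[OF sos, of x] by simp
  ultimately have "is_minimum fstar (eval_mpoly f ` ?V)"
    and "is_arg_min (eval_mpoly f) (\<lambda>x. x \<in> ?V) xstar"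
    using assms(6) by (force simp: is_minimum_def is_arg_min_def)+
  moreover have "eval_mpoly f constant_on ?V" if "k = 0"
  proof -
    have "total_degree \<sigma> = 0"
      using sos that by (simp add: sos_mpoly_def)
    then have "eval_mpoly \<sigma> x = 0" for x
      using eval_mpoly_degree_0[of \<sigma> x xstar] slack(1) by simp
    then show ?thesis
      using on_V unfolding constant_on_def by auto
  qed
  ultimately show ?thesis
    by blast
qed

end
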